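(* Let $G$ be a finite group, $m$ a positive integer, and let $\Gamma=\mathrm{Cay}(G,S_{i,j}:1\le i,j\le m)$ be an $m$-PCayley digraph (respectively, $m$-PCayley graph) of $G$. Then $\Gamma$ is $m$PCI if and only if every semiregular subgroup of $\mathrm{Aut}(\Gamma)$ that is isomorphic to $G$ and has the same orbit set $\{G_1,\dots,G_m\}$ as $R(G)$ is conjugate to $R(G)$ in $\mathrm{Aut}(\Gamma)$.
   Context: Digraphs are finite without loops or multiple arcs; a graph is a digraph with symmetric arc set. A permutation group is semiregular if all point stabilizers are trivial. $V=\bigcup_{i=1}^m G_i$ is a disjoint union of copies $G_i=\{x_i:x\in G\}$ of $G$. For subsets $S_{i,j}\subseteq G$ ($1\le i,j\le m$) with $1\notin S_{i,i}$, the $m$-Cayley digraph $\mathrm{Cay}(G,S_{i,j}:1\le i,j\le m)$ has vertex set $V$ and arc set $\bigcup_{i,j}\{(x_i,(sx)_j): s\in S_{i,j},x\in G\}$. It is an $m$-PCayley digraph if $S_{i,i}=\emptyset$ for all $i$, and an $m$-PCayley graph if in addition it is a graph, i.e. $S_{i,j}=S_{j,i}^{-1}$ for all $i,j$. $R(G)=\{R(g):g\in G\}$ with $R(g):x_i\mapsto(xg)_i$ for all $x\in G$ and all $i$, and $N=N_{\mathrm{S}_V}(R(G))$ is its normalizer in the symmetric group on $V$. For a permutation $n$ of $V$, $\Gamma^n$ is the digraph with vertex set $V$ and arcs $(u^n,v^n)$ for $(u,v)$ an arc of $\Gamma$. Two $m$-PCayley (di)graphs $\Gamma,\Sigma$ of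 $G$ are $p$-isomorphic if there is an isomorphism from $\Gamma$ to $\Sigma$ mapping each $G_i$ onto some $G_j$. An $m$-PCayley (di)graph $\Gamma$ of $G$ is called $m$PCI if for every $m$-PCayley (di)graph $\Sigma$ of $G$ that is $p$-isomorphic to $\Gamma$ there is $n\in N$ with $\Gamma^n=\Sigma$. *)

theory Defs
  imports "HOL-Algebra.Group_Action" "Graph_Theory.Pair_Digraph"
begin

text \<open>The vertex x_i is encoded as the pair (x, i), with i ranging over 1, ..., m.
  Permutations of a set V are the members of \<^term>\<open>Bij V\<close>, i.e. bijections of V that are
  undefined outside V, and the symmetric group on V is \<^term>\<open>BijGroup V\<close>.\<close>

definition layer :: "('a, 'b) monoid_scheme \<Rightarrow> nat \<Rightarrow> ('a \<times> nat) set"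
  where "layer G i = carrier G \<times> {i}"

definition vset :: "('a, 'b) monoid_scheme \<Rightarrow> nat \<Rightarrow> ('a \<times> nat) set"
  where "vset G m = (\<Union>i\<in>{1..m}. layer G i)"


section \<open>m-Cayley digraphs\<close>

definition connection_sets ::
    "('a, 'b) monoid_scheme \<Rightarrow> nat \<Rightarrow> (nat \<Rightarrow> nat \<Rightarrow> 'a set) \<Rightarrow> bool"
  where "connection_sets G m S \<longleftrightarrow>
    (\<forall>i\<in>{1..m}. \<forall>j\<in>{1..m}. S i j \<subseteq> carrier G) \<and> (\<forall>i\<in>{1..m}. \<one>\<^bsub>G\<^esub> \<notin> S i i)"

definition m_Cayley ::
    "('a, 'b) monoid_scheme \<Rightarrow> nat \<Rightarrow> (nat \<Rightarrow> nat \<Rightarrow> 'a set) \<Rightarrow> ('a \<times> nat) pair_pre_digraph"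
  where "m_Cayley G m S =
    \<lparr>pverts = vset G m,
     parcs = (\<Union>i\<in>{1..m}. \<Union>j\<in>{1..m}.
       {((x, i), (s \<otimes>\<^bsub>G\<^esub> x, j)) | s x. s \<in> S i j \<and> x \<in> carrier G})\<rparr>"

definition m_PCayley_digraph ::
    "('a, 'b) monoid_scheme \<Rightarrow> nat \<Rightarrow> ('a \<times> nat) pair_pre_digraph \<Rightarrow> bool"
  where "m_PCayley_digraph G m \<Gamma> \<longleftrightarrow>
    (\<exists>S. connection_sets G m S \<and> (\<forall>i\<in>{1..m}. S i i = {}) \<and> \<Gamma> = m_Cayley G m S)"

text \<open>\<^const>\<open>pair_graph\<close> means finite, without loops and with symmetric arc set.
  The lemma \<open>pair_graph_m_Cayley_iff\<close> below translates this to the connection sets.\<close>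

definition m_PCayley_graph ::
    "('a, 'b) monoid_scheme \<Rightarrow> nat \<Rightarrow> ('a \<times> nat) pair_pre_digraph \<Rightarrow> bool"
  where "m_PCayley_graph G m \<Gamma> \<longleftrightarrow> m_PCayley_digraph G m \<Gamma> \<and> pair_graph \<Gamma>"


section \<open>Isomorphisms and automorphisms\<close>

definition vertex_iso ::
    "'v pair_pre_digraph \<Rightarrow> 'w pair_pre_digraph \<Rightarrow> ('v \<Rightarrow> 'w) \<Rightarrow> bool"
  where "vertex_iso \<Gamma> \<Sigma> f \<longleftrightarrow>
    bij_betw f (pverts \<Gamma>) (pverts \<Sigma>) \<and>
    (\<forall>u\<in>pverts \<Gamma>. \<forall>v\<in>pverts \<Gamma>. (u, v) \<in> parcs \<Gamma> \<longleftrightarrow> (f u, f v) \<in> parcs \<Sigma>)"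

definition p_isomorphic ::
    "('a, 'b) monoid_scheme \<Rightarrow> nat \<Rightarrow> ('a \<times> nat) pair_pre_digraph \<Rightarrow>
     ('a \<times> nat) pair_pre_digraph \<Rightarrow> bool"
  where "p_isomorphic G m \<Gamma> \<Sigma> \<longleftrightarrow>
    (\<exists>f. vertex_iso \<Gamma> \<Sigma> f \<and> (\<forall>i\<in>{1..m}. \<exists>j\<in>{1..m}. f ` layer G i = layer G j))"

definition Aut_digraph :: "'v pair_pre_digraph \<Rightarrow> ('v \<Rightarrow> 'v) monoid"
  where "Aut_digraph \<Gamma> =
    BijGroup (pverts \<Gamma>) \<lparr>carrier := {f \<in> Bij (pverts \<Gamma>). vertex_iso \<Gamma> \<Gamma> f}\<rparr>"

definition image_digraph ::
    "('v \<Rightarrow> 'v) \<Rightarrow> 'v pair_pre_digraph \<Rightarrow> 'v pair_pre_digraph"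
  where "image_digraph n \<Gamma> =
    \<lparr>pverts = pverts \<Gamma>, parcs = {(n u, n v) | u v. (u, v) \<in> parcs \<Gamma>}\<rparr>"


section \<open>Permutation groups\<close>

text \<open>A permutation group is given by its set X of elements, a subgroup of some group A of
  bijections, which acts by evaluation.\<close>

definition semiregular :: "('v \<Rightarrow> 'v) monoid \<Rightarrow> ('v \<Rightarrow> 'v) set \<Rightarrow> 'v set \<Rightarrow> bool"
  where "semiregular A X V \<longleftrightarrow>
    (\<forall>v\<in>V. stabilizer (A\<lparr>carrier := X\<rparr>) (\<lambda>f. f) v = {\<one>\<^bsub>A\<^esub>})"

definition orbit_set :: "('v \<Rightarrow> 'v) monoid \<Rightarrow> ('v \<Rightarrow> 'v) set \<Rightarrow> 'v set \<Rightarrow> 'v set set"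
  where "orbit_set A X V = orbits (A\<lparr>carrier := X\<rparr>) V (\<lambda>f. f)"

definition conjugate_in :: "('g, 'b) monoid_scheme \<Rightarrow> 'g set \<Rightarrow> 'g set \<Rightarrow> bool"
  where "conjugate_in A X Y \<longleftrightarrow> (\<exists>a\<in>carrier A. a <#\<^bsub>A\<^esub> X #>\<^bsub>A\<^esub> inv\<^bsub>A\<^esub> a = Y)"

definition R_perm :: "('a, 'b) monoid_scheme \<Rightarrow> nat \<Rightarrow> 'a \<Rightarrow> ('a \<times> nat \<Rightarrow> 'a \<times> nat)"
  where "R_perm G m g = (\<lambda>(x, i) \<in> vset G m. (x \<otimes>\<^bsub>G\<^esub> g, i))"

definition R_group :: "('a, 'b) monoid_scheme \<Rightarrow> nat \<Rightarrow> ('a \<times> nat \<Rightarrow> 'a \<times> nat) set"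
  where "R_group G m = R_perm G m ` carrier G"

definition N_group :: "('a, 'b) monoid_scheme \<Rightarrow> nat \<Rightarrow> ('a \<times> nat \<Rightarrow> 'a \<times> nat) set"
  where "N_group G m = normalizer (BijGroup (vset G m)) (R_group G m)"


section \<open>The mPCI property\<close>

text \<open>For a digraph the competitors \<open>\<Sigma>\<close> are m-PCayley digraphs; for a graph they are
  m-PCayley graphs.\<close>

definition mPCI_digraph ::
    "('a, 'b) monoid_scheme \<Rightarrow> nat \<Rightarrow> ('a \<times> nat) pair_pre_digraph \<Rightarrow> bool"
  where "mPCI_digraph G m \<Gamma> \<longleftrightarrow>
    (\<forall>\<Sigma>. m_PCayley_digraph G m \<Sigma> \<and> p_isomorphic G m \<Gamma> \<Sigma> \<longrightarrow>
       (\<exists>n\<in>N_group G m. image_digraph n \<Gamma> = \<Sigma>))"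

definition mPCI_graph ::
    "('a, 'b) monoid_scheme \<Rightarrow> nat \<Rightarrow> ('a \<times> nat) pair_pre_digraph \<Rightarrow> bool"
  where "mPCI_graph G m \<Gamma> \<longleftrightarrow>
    (\<forall>\<Sigma>. m_PCayley_graph G m \<Sigma> \<and> p_isomorphic G m \<Gamma> \<Sigma> \<longrightarrow>
       (\<exists>n\<in>N_group G m. image_digraph n \<Gamma> = \<Sigma>))"


section \<open>Consistency of the definitions\<close>

lemma in_parcs_m_Cayley_iff:
  assumes "group G" and S: "connection_sets G m S"
  shows "((x, i), (y, j)) \<in> parcs (m_Cayley G m S) \<longleftrightarrow>
    i \<in> {1..m} \<and> j \<in> {1..m} \<and> x \<in> carrier G \<and> y \<in> carrier G \<and> y \<otimes>\<^bsub>G\<^esub> inv\<^bsub>G\<^esub> x \<in> S i j"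
proof -
  interpret group G by fact
  have sub: "s \<in> carrier G" if "s \<in> S i j" "i \<in> {1..m}" "j \<in> {1..m}" for s
    using S that unfolding connection_sets_def by blast
  have a: "(s \<otimes>\<^bsub>G\<^esub> x) \<otimes>\<^bsub>G\<^esub> inv\<^bsub>G\<^esub> x = s" if "s \<in> carrier G" "x \<in> carrier G" for s
    using that by (simp add: m_assoc)
  have b: "y = (y \<otimes>\<^bsub>G\<^esub> inv\<^bsub>G\<^esub> x) \<otimes>\<^bsub>G\<^esub> x" if "y \<in> carrier G" "x \<in> carrier G"
    using that by (simp add: m_assoc)
  show ?thesis
  proof
    assume "((x, i), (y, j)) \<in> parcs (m_Cayley G m S)"
    then obtain s where "i \<in> {1..m}" "j \<in> {1..m}" "x \<in> carrier G" "s \<in> S i j"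
      "y = s \<otimes>\<^bsub>G\<^esub> x"
      unfolding m_Cayley_def by auto
    then show "i \<in> {1..m} \<and> j \<in> {1..m} \<and> x \<in> carrier G \<and> y \<in> carrier G \<and>
        y \<otimes>\<^bsub>G\<^esub> inv\<^bsub>G\<^esub> x \<in> S i j"
      using sub a by force
  next
    assume r: "i \<in> {1..m} \<and> j \<in> {1..m} \<and> x \<in> carrier G \<and> y \<in> carrier G \<and>
        y \<otimes>\<^bsub>G\<^esub> inv\<^bsub>G\<^esub> x \<in> S i j"
    then have "((x, i), (y, j)) \<in>
        {((x, i), (s \<otimes>\<^bsub>G\<^esub> x, j)) | s x. s \<in> S i j \<and> x \<in> carrier G}"
      using b by blast
    then show "((x, i), (y, j)) \<in> parcs (m_Cayley G m S)"
      using r unfolding m_Cayley_def by auto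
  qed
qed

lemma pair_graph_m_Cayley_iff:
  assumes "group G" and fin: "finite (carrier G)" and S: "connection_sets G m S"
  shows "pair_graph (m_Cayley G m S) \<longleftrightarrow>
    (\<forall>i\<in>{1..m}. \<forall>j\<in>{1..m}. S i j = set_inv\<^bsub>G\<^esub> (S j i))"
proof -
  interpret group G by fact
  note arc = in_parcs_m_Cayley_iff[OF \<open>group G\<close> S]
  have sub: "s \<in> carrier G" if "s \<in> S i j" "i \<in> {1..m}" "j \<in> {1..m}" for s i j
    using S that unfolding connection_sets_def by blast
  have verts: "pverts (m_Cayley G m S) = carrier G \<times> {1..m}"
    by (auto simp: m_Cayley_def vset_def layer_def)
  have sub2: "parcs (m_Cayley G m S) \<subseteq> (carrier G \<times> {1..m}) \<times> (carrier G \<times> {1..m})"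
    using arc by auto
  have "finite (parcs (m_Cayley G m S))"
    by (rule finite_subset[OF sub2]) (use fin in auto)
  moreover have "fst e \<noteq> snd e" if "e \<in> parcs (m_Cayley G m S)" for e
    using that S unfolding connection_sets_def
    by (cases e; cases "fst e"; cases "snd e") (auto simp: arc)
  ultimately have "pair_digraph (m_Cayley G m S)"
    by unfold_locales (use sub2 fin in \<open>auto simp: verts\<close>)
  then have "pair_graph (m_Cayley G m S) \<longleftrightarrow> sym (parcs (m_Cayley G m S))"
    unfolding pair_graph_def pair_pseudo_graph_def pair_sym_digraph_def
      pair_sym_digraph_axioms_def symmetric_def pair_digraph_def pair_fin_digraph_def
    by auto
  also have "\<dots> \<longleftrightarrow> (\<forall>i\<in>{1..m}. \<forall>j\<in>{1..m}. S i j = set_inv\<^bsub>G\<^esub> (S j i))"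
  proof
    assume sym: "sym (parcs (m_Cayley G m S))"
    have inv: "inv\<^bsub>G\<^esub> s \<in> S j i" if "i \<in> {1..m}" "j \<in> {1..m}" "s \<in> S i j" for i j s
    proof -
      have "((\<one>\<^bsub>G\<^esub>, i), (s, j)) \<in> parcs (m_Cayley G m S)"
        using that sub by (auto simp: arc)
      then have "((s, j), (\<one>\<^bsub>G\<^esub>, i)) \<in> parcs (m_Cayley G m S)"
        using sym by (meson symD)
      then show ?thesis using that sub by (auto simp: arc)
    qed
    show "\<forall>i\<in>{1..m}. \<forall>j\<in>{1..m}. S i j = set_inv\<^bsub>G\<^esub> (S j i)"
    proof (intro ballI equalityI subsetI)
      fix i j s assume ij: "i \<in> {1..m}" "j \<in> {1..m}" and s: "s \<in> S i j"
      show "s \<in> set_inv\<^bsub>G\<^esub> (S j i)"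
        using inv[OF ij s] sub[OF s ij] unfolding SET_INV_def by (metis UN_I inv_inv singletonI)
    next
      fix i j s assume "i \<in> {1..m}" "j \<in> {1..m}" "s \<in> set_inv\<^bsub>G\<^esub> (S j i)"
      then show "s \<in> S i j" using inv unfolding SET_INV_def by auto
    qed
  next
    assume r: "\<forall>i\<in>{1..m}. \<forall>j\<in>{1..m}. S i j = set_inv\<^bsub>G\<^esub> (S j i)"
    show "sym (parcs (m_Cayley G m S))"
    proof (rule symI)
      fix u v assume uv: "(u, v) \<in> parcs (m_Cayley G m S)"
      obtain x i y j where [simp]: "u = (x, i)" "v = (y, j)" by (cases u; cases v)
      have h: "i \<in> {1..m}" "j \<in> {1..m}" "x \<in> carrier G" "y \<in> carrier G"
        "y \<otimes>\<^bsub>G\<^esub> inv\<^bsub>G\<^esub> x \<in> S i j"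
        using uv unfolding \<open>u = (x, i)\<close> \<open>v = (y, j)\<close> arc by auto
      have "inv\<^bsub>G\<^esub> (y \<otimes>\<^bsub>G\<^esub> inv\<^bsub>G\<^esub> x) \<in> S j i"
        using r h(1,2,5) unfolding SET_INV_def by blast
      then show "(v, u) \<in> parcs (m_Cayley G m S)"
        using h by (simp add: arc inv_mult_group)
    qed
  qed
  finally show ?thesis .
qed

lemma orbit_set_R_group:
  assumes "group G"
  shows "orbit_set (BijGroup (vset G m)) (R_group G m) (vset G m) = layer G ` {1..m}"
proof -
  interpret group G by fact
  have orb: "{f (x, i) | f. f \<in> R_group G m} = layer G i"
    if "x \<in> carrier G" "i \<in> {1..m}" for x i
  proof -
    have v: "(x, i) \<in> vset G m" using that by (auto simp: vset_def layer_def)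
    have "{f (x, i) | f. f \<in> R_group G m} = (\<lambda>g. (x \<otimes>\<^bsub>G\<^esub> g, i)) ` carrier G"
      unfolding R_group_def Setcompr_eq_image using v by (simp add: image_image R_perm_def)
    also have "\<dots> = (\<lambda>g. x \<otimes>\<^bsub>G\<^esub> g) ` carrier G \<times> {i}" by auto
    also have "(\<lambda>g. x \<otimes>\<^bsub>G\<^esub> g) ` carrier G = carrier G"
      using that(1) surj_const_mult by auto
    finally show ?thesis by (simp add: layer_def)
  qed
  have "orbit_set (BijGroup (vset G m)) (R_group G m) (vset G m) =
      (\<lambda>v. {f v | f. f \<in> R_group G m}) ` vset G m"
    by (auto simp: orbit_set_def orbits_def orbit_def)
  also have "\<dots> = layer G ` {1..m}"
  proof (intro equalityI subsetI)
    fix A assume "A \<in> (\<lambda>v. {f v | f. f \<in> R_group G m}) ` vset G m"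
    then obtain x i where "x \<in> carrier G" "i \<in> {1..m}" "A = {f (x, i) | f. f \<in> R_group G m}"
      by (auto simp: vset_def layer_def)
    then show "A \<in> layer G ` {1..m}" using orb by blast
  next
    fix A assume "A \<in> layer G ` {1..m}"
    then obtain i where i: "i \<in> {1..m}" "A = layer G i" by blast
    then have "(\<one>\<^bsub>G\<^esub>, i) \<in> vset G m" by (auto simp: vset_def layer_def)
    then show "A \<in> (\<lambda>v. {f v | f. f \<in> R_group G m}) ` vset G m"
      using orb[OF one_closed i(1)] i(2) by blast
  qed
  finally show ?thesis .
qed

end

theory Submission
  imports Defs
begin

text \<open>This is Babai's criterion for isomorphisms of Cayley digraphs, adapted to digraphs whose
  vertex set is divided into layers. Write \<open>R\<close> for the group of right multiplications on
  the vertex set \<open>V\<close>, and let \<open>h\<close> range over the permutations of \<open>V\<close> that permute the layers.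
  Both sides of the criterion turn out to be statements about the conjugates \<open>h R h\<inverse>\<close> that
  lie in \<open>Aut \<Gamma>\<close>.

  On the group side, the semiregular groups that are isomorphic to \<open>G\<close> and have the layers as
  orbits are exactly these conjugates (\<open>conjugate_R_group_layer_regular\<close> and
  \<open>layer_regular_obtain_conjugator\<close>): such a group acts regularly on each layer, so its action
  there can be identified with right multiplication once a base point has been chosen.

  On the digraph side, an m-PCayley digraph is a digraph on \<open>V\<close> without arcs inside a layer that
  admits \<open>R\<close> as a group of automorphisms (\<open>m_PCayley_digraph_iff\<close>). Since
  \<open>h\<inverse>\<Gamma>\<close> admits \<open>R\<close> if and only if \<open>\<Gamma>\<close> admits \<open>h R h\<inverse>\<close>, the digraphs with which
  \<open>\<Gamma>\<close> has to be compared are the images \<open>h\<inverse>\<Gamma>\<close> for those \<open>h\<close> with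
  \<open>h R h\<inverse> \<subseteq> Aut \<Gamma>\<close>.

  Finally, \<open>n = (a h)\<inverse>\<close> is a correspondence between permutations \<open>n\<close> with
  \<open>n \<Gamma> = h\<inverse> \<Gamma>\<close> and automorphisms \<open>a\<close> of \<open>\<Gamma>\<close>, and \<open>n\<close> normalizes \<open>R\<close>
  if and only if \<open>a\<close> conjugates \<open>h R h\<inverse>\<close> to \<open>R\<close>. So the two sides agree for each \<open>h\<close>
  (\<open>mPCI_digraph_iff_conjugates\<close>).

  The version for graphs is a special case, because every digraph isomorphic to a graph is a
  graph: for a graph the two notions of mPCI coincide (\<open>mPCI_graph_iff_mPCI_digraph\<close>).\<close>

section \<open>Permutations acting on digraphs\<close>

definition digraph_on :: "'v set \<Rightarrow> 'v pair_pre_digraph \<Rightarrow> bool"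
  where "digraph_on V \<Gamma> \<longleftrightarrow> pverts \<Gamma> = V \<and> parcs \<Gamma> \<subseteq> V \<times> V"

lemma carrier_BijGroup [simp]: "carrier (BijGroup V) = Bij V"
  by (simp add: BijGroup_def)

lemma BijGroup_one_apply [simp]: "v \<in> V \<Longrightarrow> \<one>\<^bsub>BijGroup V\<^esub> v = v"
  by (simp add: BijGroup_def)

lemma BijGroup_mult_apply [simp]:
  "f \<in> Bij V \<Longrightarrow> g \<in> Bij V \<Longrightarrow> v \<in> V \<Longrightarrow> (f \<otimes>\<^bsub>BijGroup V\<^esub> g) v = f (g v)"
  by (simp add: BijGroup_def compose_def)

lemma Bij_apply_mem: "f \<in> Bij V \<Longrightarrow> v \<in> V \<Longrightarrow> f v \<in> V"
  by (auto simp: Bij_def bij_betw_def)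

lemma Bij_inj_on: "f \<in> Bij V \<Longrightarrow> inj_on f V"
  by (simp add: Bij_def bij_betw_def)

lemma Bij_eqI:
  assumes "f \<in> Bij V" "g \<in> Bij V" and "\<And>v. v \<in> V \<Longrightarrow> f v = g v"
  shows "f = g"
  using assms by (metis Bij_imp_extensional extensionalityI)

lemma Bij_mult_closed: "f \<in> Bij V \<Longrightarrow> g \<in> Bij V \<Longrightarrow> f \<otimes>\<^bsub>BijGroup V\<^esub> g \<in> Bij V"
  using monoid.m_closed[OF group.is_monoid[OF group_BijGroup[of V]]] by simp

lemma Bij_inv_closed: "f \<in> Bij V \<Longrightarrow> inv\<^bsub>BijGroup V\<^esub> f \<in> Bij V"
  using group.inv_closed[OF group_BijGroup[of V]] by simp

lemma BijGroup_inv_apply [simp]: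
  assumes "f \<in> Bij V" "v \<in> V"
  shows "f ((inv\<^bsub>BijGroup V\<^esub> f) v) = v" and "(inv\<^bsub>BijGroup V\<^esub> f) (f v) = v"
proof -
  interpret group "BijGroup V" by (rule group_BijGroup)
  have i: "inv\<^bsub>BijGroup V\<^esub> f \<in> Bij V" using assms by (rule_tac Bij_inv_closed)
  show "f ((inv\<^bsub>BijGroup V\<^esub> f) v) = v"
    using BijGroup_mult_apply[OF assms(1) i assms(2)] r_inv[of f] assms by simp
  show "(inv\<^bsub>BijGroup V\<^esub> f) (f v) = v"
    using BijGroup_mult_apply[OF i assms(1,2)] l_inv[of f] assms by simp
qed

lemma parcs_image_digraph: "parcs (image_digraph f \<Gamma>) = map_prod f f ` parcs \<Gamma>"
  by (auto simp: image_digraph_def map_prod_def image_iff Bex_def)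

lemma digraph_on_image_digraph:
  "digraph_on V \<Gamma> \<Longrightarrow> f \<in> Bij V \<Longrightarrow> digraph_on V (image_digraph f \<Gamma>)"
  unfolding digraph_on_def parcs_image_digraph
  by (auto simp: image_digraph_def intro: Bij_apply_mem)

lemma image_digraph_mult:
  assumes "digraph_on V \<Gamma>" "f \<in> Bij V" "g \<in> Bij V"
  shows "image_digraph (f \<otimes>\<^bsub>BijGroup V\<^esub> g) \<Gamma> = image_digraph f (image_digraph g \<Gamma>)"
proof -
  have "map_prod (f \<otimes>\<^bsub>BijGroup V\<^esub> g) (f \<otimes>\<^bsub>BijGroup V\<^esub> g) ` parcs \<Gamma> =
      map_prod f f ` map_prod g g ` parcs \<Gamma>"
    unfolding image_image by (rule image_cong) (use assms in \<open>auto simp: digraph_on_def\<close>)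
  then have "parcs (image_digraph (f \<otimes>\<^bsub>BijGroup V\<^esub> g) \<Gamma>) =
      parcs (image_digraph f (image_digraph g \<Gamma>))"
    by (simp add: parcs_image_digraph)
  then show ?thesis by (simp add: image_digraph_def)
qed

lemma image_digraph_one:
  assumes "digraph_on V \<Gamma>"
  shows "image_digraph \<one>\<^bsub>BijGroup V\<^esub> \<Gamma> = \<Gamma>"
proof -
  have "map_prod \<one>\<^bsub>BijGroup V\<^esub> \<one>\<^bsub>BijGroup V\<^esub> ` parcs \<Gamma> = id ` parcs \<Gamma>"
    by (rule image_cong) (use assms in \<open>auto simp: digraph_on_def\<close>)
  then have "parcs (image_digraph \<one>\<^bsub>BijGroup V\<^esub> \<Gamma>) = parcs \<Gamma>"
    by (simp add: parcs_image_digraph)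
  then show ?thesis by (simp add: image_digraph_def)
qed

lemma image_digraph_inv_eq_iff:
  assumes "digraph_on V \<Gamma>" "digraph_on V \<Sigma>" "f \<in> Bij V"
  shows "image_digraph (inv\<^bsub>BijGroup V\<^esub> f) \<Gamma> = \<Sigma> \<longleftrightarrow> image_digraph f \<Sigma> = \<Gamma>"
proof -
  interpret group "BijGroup V" by (rule group_BijGroup)
  have "image_digraph f (image_digraph (inv\<^bsub>BijGroup V\<^esub> f) \<Gamma>) = \<Gamma>"
    using image_digraph_mult[OF assms(1,3) Bij_inv_closed[OF assms(3)]]
      image_digraph_one[OF assms(1)] assms(3) by simp
  moreover have "image_digraph (inv\<^bsub>BijGroup V\<^esub> f) (image_digraph f \<Sigma>) = \<Sigma>"
    using image_digraph_mult[OF assms(2) Bij_inv_closed[OF assms(3)] assms(3)]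
      image_digraph_one[OF assms(2)] assms(3) by simp
  ultimately show ?thesis by metis
qed

text \<open>Isomorphisms between digraphs on the same vertex set are thereby expressed through the action
  of the symmetric group on digraphs, so that automorphism groups become stabilizers and the rest
  is group algebra.\<close>

lemma vertex_iso_iff_image_digraph:
  assumes "digraph_on V \<Gamma>" "digraph_on V \<Sigma>" "f \<in> Bij V"
  shows "vertex_iso \<Gamma> \<Sigma> f \<longleftrightarrow> image_digraph f \<Gamma> = \<Sigma>"
proof
  assume iso: "vertex_iso \<Gamma> \<Sigma> f"
  have V: "pverts \<Gamma> = V" "pverts \<Sigma> = V" "parcs \<Gamma> \<subseteq> V \<times> V" "parcs \<Sigma> \<subseteq> V \<times> V"
    using assms by (auto simp: digraph_on_def)
  have "parcs \<Sigma> \<subseteq> map_prod f f ` parcs \<Gamma>"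
  proof
    fix e assume e: "e \<in> parcs \<Sigma>"
    then have "e \<in> f ` V \<times> f ` V" using V(4) assms(3) by (auto simp: Bij_def bij_betw_def)
    then obtain u v where uv: "u \<in> V" "v \<in> V" "e = map_prod f f (u, v)" by auto
    then have "(u, v) \<in> parcs \<Gamma>" using iso e V(1) by (simp add: vertex_iso_def)
    then show "e \<in> map_prod f f ` parcs \<Gamma>" unfolding uv(3) by (rule imageI)
  qed
  moreover have "map_prod f f ` parcs \<Gamma> \<subseteq> parcs \<Sigma>"
    using iso V by (fastforce simp: vertex_iso_def)
  ultimately show "image_digraph f \<Gamma> = \<Sigma>"
    using V parcs_image_digraph[of f \<Gamma>] by (simp add: image_digraph_def)
next
  assume eq: "image_digraph f \<Gamma> = \<Sigma>"
  have V: "pverts \<Gamma> = V" "pverts \<Sigma> = V" "parcs \<Gamma> \<subseteq> V \<times> V"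
    using assms by (auto simp: digraph_on_def)
  have inj: "inj_on (map_prod f f) (V \<times> V)"
    using Bij_inj_on[OF assms(3)] by (intro map_prod_inj_on)
  have "(u, v) \<in> parcs \<Gamma> \<longleftrightarrow> (f u, f v) \<in> parcs \<Sigma>" if "u \<in> V" "v \<in> V" for u v
    using inj_on_image_mem_iff[OF inj _ V(3), of "(u, v)"] that
    unfolding eq[symmetric] parcs_image_digraph by simp
  then show "vertex_iso \<Gamma> \<Sigma> f"
    using V assms(3) by (simp add: vertex_iso_def Bij_def)
qed

lemma carrier_Aut_digraph:
  assumes "digraph_on V \<Gamma>"
  shows "carrier (Aut_digraph \<Gamma>) = {f \<in> Bij V. image_digraph f \<Gamma> = \<Gamma>}"
  using vertex_iso_iff_image_digraph[OF assms assms] assms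
  by (auto simp: Aut_digraph_def digraph_on_def)

lemma Aut_digraph_eq:
  assumes "digraph_on V \<Gamma>"
  shows "Aut_digraph \<Gamma> = BijGroup V\<lparr>carrier := carrier (Aut_digraph \<Gamma>)\<rparr>"
  using assms by (simp add: Aut_digraph_def digraph_on_def)

lemma subgroup_Aut_digraph:
  assumes "digraph_on V \<Gamma>"
  shows "subgroup (carrier (Aut_digraph \<Gamma>)) (BijGroup V)"
proof -
  interpret group "BijGroup V" by (rule group_BijGroup)
  show ?thesis
  proof (rule subgroupI)
    show "carrier (Aut_digraph \<Gamma>) \<noteq> {}"
      using image_digraph_one[OF assms] one_closed
      unfolding carrier_Aut_digraph[OF assms] by auto
  qed (use image_digraph_mult[OF assms] image_digraph_inv_eq_iff[OF assms assms] in
        \<open>auto simp: carrier_Aut_digraph[OF assms] Bij_mult_closed Bij_inv_closed\<close>)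
qed

text \<open>Stabilizers of points in the same orbit are conjugate, here for the action on digraphs.\<close>

lemma Aut_image_digraph_inv_iff:
  assumes "digraph_on V \<Gamma>" "h \<in> Bij V" "g \<in> Bij V"
  shows "g \<in> carrier (Aut_digraph (image_digraph (inv\<^bsub>BijGroup V\<^esub> h) \<Gamma>)) \<longleftrightarrow>
    h \<otimes>\<^bsub>BijGroup V\<^esub> g \<otimes>\<^bsub>BijGroup V\<^esub> inv\<^bsub>BijGroup V\<^esub> h \<in> carrier (Aut_digraph \<Gamma>)"
proof -
  let ?k = "inv\<^bsub>BijGroup V\<^esub> h"
  let ?\<Sigma> = "image_digraph ?k \<Gamma>"
  note k = Bij_inv_closed[OF assms(2)]
  have \<Sigma>: "digraph_on V ?\<Sigma>" by (rule digraph_on_image_digraph[OF assms(1) k])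
  have "image_digraph (h \<otimes>\<^bsub>BijGroup V\<^esub> g \<otimes>\<^bsub>BijGroup V\<^esub> ?k) \<Gamma> = image_digraph h (image_digraph g ?\<Sigma>)"
    using assms k \<Sigma> by (simp add: image_digraph_mult Bij_mult_closed)
  also have "\<dots> = \<Gamma> \<longleftrightarrow> ?\<Sigma> = image_digraph g ?\<Sigma>"
    using image_digraph_inv_eq_iff[OF assms(1) digraph_on_image_digraph[OF \<Sigma> assms(3)] assms(2)]
    by simp
  finally show ?thesis
    using assms k \<Sigma> by (auto simp: carrier_Aut_digraph Bij_mult_closed)
qed

lemma conjugate_eq_image:
  fixes A (structure)
  shows "a <# X #> inv a = (\<lambda>x. a \<otimes> x \<otimes> inv a) ` X"
  by (auto simp: l_coset_def r_coset_def)

lemma (in group) conjugate_mult: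
  assumes "a \<in> carrier G" "b \<in> carrier G" "X \<subseteq> carrier G"
  shows "a <# (b <# X #> inv b) #> inv a = (a \<otimes> b) <# X #> inv (a \<otimes> b)"
  unfolding conjugate_eq_image image_image
  by (rule image_cong) (use assms in \<open>auto simp: m_assoc inv_mult_group subset_iff\<close>)

lemma (in group) conjugate_inv_eq_iff:
  assumes "a \<in> carrier G" "X \<subseteq> carrier G" "Y \<subseteq> carrier G"
  shows "inv a <# X #> inv (inv a) = Y \<longleftrightarrow> a <# Y #> inv a = X"
proof -
  have one: "\<one> <# Z #> inv \<one> = Z" if "Z \<subseteq> carrier G" for Z
    using that by (simp add: lcos_mult_one)
  show ?thesis
    using conjugate_mult[of a "inv a" X] conjugate_mult[of "inv a" a Y] one assms
    by (metis inv_closed l_inv r_inv)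
qed

text \<open>Products and inverses in the automorphism group are those of the symmetric group, so all
  conjugation can be carried out in the latter.\<close>

lemma conjugate_in_Aut_digraph_iff:
  assumes "digraph_on V \<Gamma>" "X \<subseteq> carrier (Aut_digraph \<Gamma>)"
  shows "conjugate_in (Aut_digraph \<Gamma>) X Y \<longleftrightarrow>
    (\<exists>a\<in>carrier (Aut_digraph \<Gamma>). a <#\<^bsub>BijGroup V\<^esub> X #>\<^bsub>BijGroup V\<^esub> inv\<^bsub>BijGroup V\<^esub> a = Y)"
proof -
  let ?C = "carrier (Aut_digraph \<Gamma>)"
  have inv: "inv\<^bsub>Aut_digraph \<Gamma>\<^esub> a = inv\<^bsub>BijGroup V\<^esub> a" if "a \<in> ?C" for a
    using group.m_inv_consistent[OF group_BijGroup subgroup_Aut_digraph[OF assms(1)] that]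
      Aut_digraph_eq[OF assms(1)] by metis
  have "x \<otimes>\<^bsub>Aut_digraph \<Gamma>\<^esub> y = x \<otimes>\<^bsub>BijGroup V\<^esub> y" for x y
    by (subst Aut_digraph_eq[OF assms(1)]) simp
  then show ?thesis
    by (simp add: conjugate_in_def inv l_coset_def r_coset_def cong: bex_cong)
qed


section \<open>The regular group and its layers\<close>

lemma mem_vset_iff: "(x, i) \<in> vset G m \<longleftrightarrow> x \<in> carrier G \<and> i \<in> {1..m}"
  by (auto simp: vset_def layer_def)

context group
begin

lemma R_perm_apply [simp]: "(x, i) \<in> vset G m \<Longrightarrow> R_perm G m g (x, i) = (x \<otimes> g, i)"
  by (simp add: R_perm_def)

lemma R_perm_Bij: 
  assumes g: "g \<in> carrier G"
  shows "R_perm G m g \<in> Bij (vset G m)"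
proof -
  have "bij_betw (R_perm G m g) (vset G m) (vset G m)"
  proof (rule bij_betw_byWitness[where f' = "R_perm G m (inv g)"])
  qed (use g in \<open>auto simp: mem_vset_iff m_assoc\<close>)
  then show ?thesis by (auto simp: Bij_def R_perm_def)
qed

text \<open>With maps composed from right to left, right multiplication reverses products.\<close>

lemma R_perm_mult:
  assumes "g \<in> carrier G" "h \<in> carrier G"
  shows "R_perm G m g \<otimes>\<^bsub>BijGroup (vset G m)\<^esub> R_perm G m h = R_perm G m (h \<otimes> g)"
  by (rule Bij_eqI[where V = "vset G m"])
    (use assms in \<open>auto simp: Bij_mult_closed R_perm_Bij mem_vset_iff m_assoc\<close>)

lemma R_perm_one: "R_perm G m \<one> = \<one>\<^bsub>BijGroup (vset G m)\<^esub>"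
  using monoid.one_closed[OF group.is_monoid[OF group_BijGroup[of "vset G m"]]]
  by (intro Bij_eqI[where V = "vset G m"]) (auto simp: R_perm_Bij mem_vset_iff)

lemma R_group_subset: "R_group G m \<subseteq> Bij (vset G m)"
  by (auto simp: R_group_def R_perm_Bij)

lemma subgroup_R_group: "subgroup (R_group G m) (BijGroup (vset G m))"
proof -
  interpret A: group "BijGroup (vset G m)" by (rule group_BijGroup)
  have inv: "inv\<^bsub>BijGroup (vset G m)\<^esub> (R_perm G m g) = R_perm G m (inv g)"
    if "g \<in> carrier G" for g
    by (rule A.inv_equality) (use that in \<open>auto simp: R_perm_mult R_perm_one R_perm_Bij\<close>)
  show ?thesis
    by (rule A.subgroupI) (use R_group_subset in \<open>auto simp: R_group_def inv R_perm_mult\<close>)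
qed

lemma N_group_eq:
  "N_group G m = {n \<in> Bij (vset G m). n <#\<^bsub>BijGroup (vset G m)\<^esub> R_group G m
     #>\<^bsub>BijGroup (vset G m)\<^esub> inv\<^bsub>BijGroup (vset G m)\<^esub> n = R_group G m}"
  using R_group_subset by (auto simp: N_group_def normalizer_def stabilizer_def)

end

text \<open>Asking for the set of layers to be mapped onto itself, rather than into itself, makes closure
  under inverses immediate and shows at once that orbit sets consisting of the layers are kept.\<close>

definition layer_perms :: "('a, 'b) monoid_scheme \<Rightarrow> nat \<Rightarrow> ('a \<times> nat \<Rightarrow> 'a \<times> nat) set"
  where "layer_perms G m =
    {f \<in> Bij (vset G m). (`) f ` layer G ` {1..m} = layer G ` {1..m}}"

lemma layer_subset: "i \<in> {1..m} \<Longrightarrow> layer G i \<subseteq> vset G m"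
  by (auto simp: vset_def)

lemma layer_perms_Bij: "f \<in> layer_perms G m \<Longrightarrow> f \<in> Bij (vset G m)"
  by (simp add: layer_perms_def)

text \<open>There are finitely many layers and a permutation maps distinct layers to distinct sets, so a
  permutation that sends layers to layers permutes them.\<close>

lemma layer_permsI:
  assumes "f \<in> Bij (vset G m)" "\<And>i. i \<in> {1..m} \<Longrightarrow> \<exists>j\<in>{1..m}. f ` layer G i = layer G j"
  shows "f \<in> layer_perms G m"
proof -
  let ?L = "layer G ` {1..m}"
  have "(`) f ` ?L = ?L"
  proof (rule endo_inj_surj)
    show "(`) f ` ?L \<subseteq> ?L" using assms(2) by fastforce
    have "inj_on ((`) f) (Pow (vset G m))"
      using Bij_inj_on[OF assms(1)] by (rule inj_on_image_Pow)
    then show "inj_on ((`) f) ?L"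
      by (rule inj_on_subset) (use layer_subset in blast)
  qed simp
  then show ?thesis using assms(1) by (simp add: layer_perms_def)
qed

lemma layer_perms_inv:
  assumes "f \<in> layer_perms G m"
  shows "inv\<^bsub>BijGroup (vset G m)\<^esub> f \<in> layer_perms G m"
proof (rule layer_permsI)
  show "inv\<^bsub>BijGroup (vset G m)\<^esub> f \<in> Bij (vset G m)"
    using assms by (simp add: Bij_inv_closed layer_perms_def)
  fix i assume i: "i \<in> {1..m}"
  have "layer G i \<in> (`) f ` layer G ` {1..m}" using assms i by (simp add: layer_perms_def)
  then obtain j where j: "j \<in> {1..m}" "layer G i = f ` layer G j" by auto
  have "(inv\<^bsub>BijGroup (vset G m)\<^esub> f) ` f ` layer G j = id ` layer G j"
    unfolding image_image
    by (rule image_cong)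
      (use layer_subset[OF j(1), of G] layer_perms_Bij[OF assms] in \<open>auto simp: subset_iff\<close>)
  then show "\<exists>j\<in>{1..m}. (inv\<^bsub>BijGroup (vset G m)\<^esub> f) ` layer G i = layer G j"
    using j by auto
qed

text \<open>A p-isomorphism may take any values outside the vertex set; restricting it yields a
  permutation in the sense of \<^const>\<open>Bij\<close>.\<close>

lemma p_isomorphic_iff_layer_perms:
  assumes \<Gamma>: "digraph_on (vset G m) \<Gamma>" and \<Sigma>: "digraph_on (vset G m) \<Sigma>"
  shows "p_isomorphic G m \<Gamma> \<Sigma> \<longleftrightarrow> (\<exists>f\<in>layer_perms G m. image_digraph f \<Gamma> = \<Sigma>)"
proof
  let ?V = "vset G m"
  have V: "pverts \<Gamma> = ?V" "pverts \<Sigma> = ?V" using assms by (auto simp: digraph_on_def)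
  assume "p_isomorphic G m \<Gamma> \<Sigma>"
  then obtain f where f: "vertex_iso \<Gamma> \<Sigma> f"
    and lay: "\<And>i. i \<in> {1..m} \<Longrightarrow> \<exists>j\<in>{1..m}. f ` layer G i = layer G j"
    by (auto simp: p_isomorphic_def)
  let ?f = "restrict f ?V"
  have B: "?f \<in> Bij ?V"
    using f V bij_betw_cong[of ?V ?f f ?V] by (simp add: vertex_iso_def Bij_def)
  have "vertex_iso \<Gamma> \<Sigma> ?f"
    using f B V by (auto simp: vertex_iso_def Bij_def)
  then have "image_digraph ?f \<Gamma> = \<Sigma>"
    using vertex_iso_iff_image_digraph[OF \<Gamma> \<Sigma> B] by simp
  moreover have "?f \<in> layer_perms G m"
  proof (rule layer_permsI[OF B])
    fix i assume i: "i \<in> {1..m}"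
    have "?f ` layer G i = f ` layer G i"
      by (rule image_cong) (use layer_subset[OF i, of G] in auto)
    then show "\<exists>j\<in>{1..m}. ?f ` layer G i = layer G j" using lay[OF i] by simp
  qed
  ultimately show "\<exists>f\<in>layer_perms G m. image_digraph f \<Gamma> = \<Sigma>" by blast
next
  assume "\<exists>f\<in>layer_perms G m. image_digraph f \<Gamma> = \<Sigma>"
  then obtain f where f: "f \<in> layer_perms G m" "image_digraph f \<Gamma> = \<Sigma>" by blast
  have "f ` layer G i \<in> layer G ` {1..m}" if "i \<in> {1..m}" for i
    using f(1) that unfolding layer_perms_def by blast
  then show "p_isomorphic G m \<Gamma> \<Sigma>"
    using vertex_iso_iff_image_digraph[OF \<Gamma> \<Sigma> layer_perms_Bij[OF f(1)]] f(2)
    unfolding p_isomorphic_def by blast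
qed


section \<open>Semiregular groups with the layers as orbits\<close>

lemma semiregular_iff:
  "semiregular A X V \<longleftrightarrow> (\<forall>v\<in>V. {f \<in> X. f v = v} = {\<one>\<^bsub>A\<^esub>})"
  by (simp add: semiregular_def stabilizer_def)

lemma orbit_set_eq: "orbit_set A X V = (\<lambda>v. (\<lambda>f. f v) ` X) ` V"
  by (auto simp: orbit_set_def orbits_def orbit_def image_def Bex_def)

text \<open>The properties hold for \<open>R\<close> itself, and each is carried over by conjugation: \<open>h\<close> maps
  fixed points to fixed points, and it maps the orbits of \<open>R\<close>, which are the layers, to the orbits
  of the conjugate.\<close>

lemma (in group) conjugate_R_group_layer_regular:
  assumes m: "0 < m" and h: "h \<in> layer_perms G m"
  defines "A \<equiv> BijGroup (vset G m)"
  defines "X \<equiv> h <#\<^bsub>A\<^esub> R_group G m #>\<^bsub>A\<^esub> inv\<^bsub>A\<^esub> h"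
  shows "subgroup X A" and "semiregular A X (vset G m)" and "A\<lparr>carrier := X\<rparr> \<cong> G"
    and "orbit_set A X (vset G m) = layer G ` {1..m}"
proof -
  let ?V = "vset G m"
  interpret A: group A unfolding A_def by (rule group_BijGroup)
  have hB: "h \<in> carrier A" using h by (simp add: A_def layer_perms_Bij)
  have hV: "h \<in> Bij ?V" using h by (rule layer_perms_Bij)
  have iV: "inv\<^bsub>A\<^esub> h \<in> Bij ?V" unfolding A_def by (rule Bij_inv_closed[OF hV])
  have RA: "R_group G m \<subseteq> carrier A" using R_group_subset by (simp add: A_def)
  define c where "c g = h \<otimes>\<^bsub>A\<^esub> R_perm G m g \<otimes>\<^bsub>A\<^esub> inv\<^bsub>A\<^esub> h" for g
  have X: "X = c ` carrier G"
    by (simp add: X_def conjugate_eq_image R_group_def image_image c_def)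
  have Rc: "R_perm G m g \<in> carrier A" if "g \<in> carrier G" for g
    using that by (simp add: A_def R_perm_Bij)
  have c_apply: "c g v = h (R_perm G m g ((inv\<^bsub>A\<^esub> h) v))"
    if "g \<in> carrier G" "v \<in> ?V" for g v
    using that hV iV R_perm_Bij[OF that(1), of m] Bij_apply_mem[OF iV]
    unfolding c_def A_def by (simp add: Bij_mult_closed)
  have iV_apply: "(inv\<^bsub>A\<^esub> h) v \<in> ?V" "h ((inv\<^bsub>A\<^esub> h) v) = v" if "v \<in> ?V" for v
    using that iV hV by (auto simp: A_def Bij_apply_mem)
  show sub: "subgroup X A"
    unfolding X_def
    by (rule A.subgroup_conjugation_is_surj2[OF hB]) (simp add: A_def subgroup_R_group)
  have fixed: "g = \<one>" if "g \<in> carrier G" "v \<in> ?V" "c g v = v" for g v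
  proof -
    obtain x i where xi: "(inv\<^bsub>A\<^esub> h) v = (x, i)" by (cases "(inv\<^bsub>A\<^esub> h) v")
    have u: "(x, i) \<in> ?V" using iV_apply(1)[OF that(2)] xi by simp
    have "h (R_perm G m g (x, i)) = h (x, i)"
      using that c_apply iV_apply(2)[OF that(2)] xi by simp
    then have "R_perm G m g (x, i) = (x, i)"
      using Bij_inj_on[OF hV] u Bij_apply_mem[OF R_perm_Bij[OF that(1)] u]
      by (auto dest: inj_onD)
    then show ?thesis using u that(1) by (simp add: mem_vset_iff)
  qed
  have "R_perm G m \<one> = \<one>\<^bsub>A\<^esub>" unfolding A_def by (rule R_perm_one)
  then have c1: "c \<one> = \<one>\<^bsub>A\<^esub>" using hB by (simp add: c_def)
  show "semiregular A X ?V"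
    unfolding semiregular_iff
  proof (intro ballI equalityI subsetI)
    fix v f assume "v \<in> ?V" "f \<in> {f \<in> X. f v = v}"
    then obtain g where "g \<in> carrier G" "f = c g" "c g v = v" "v \<in> ?V" by (auto simp: X)
    then show "f \<in> {\<one>\<^bsub>A\<^esub>}" using fixed c1 by blast
  next
    fix v f assume "v \<in> ?V" "f \<in> {\<one>\<^bsub>A\<^esub>}"
    then show "f \<in> {f \<in> X. f v = v}"
      using subgroup.one_closed[OF sub] by (auto simp: A_def)
  qed
  show "A\<lparr>carrier := X\<rparr> \<cong> G"
  proof (rule iso_sym)
    have c_mult: "c g \<otimes>\<^bsub>A\<^esub> c k = c (k \<otimes> g)" if "g \<in> carrier G" "k \<in> carrier G" for g k
    proof -
      have cancel: "inv\<^bsub>A\<^esub> h \<otimes>\<^bsub>A\<^esub> (h \<otimes>\<^bsub>A\<^esub> z) = z" if "z \<in> carrier A" for z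
        using that hB by (simp add: A.m_assoc[symmetric])
      have "c g \<otimes>\<^bsub>A\<^esub> c k = h \<otimes>\<^bsub>A\<^esub> (R_perm G m g \<otimes>\<^bsub>A\<^esub> R_perm G m k) \<otimes>\<^bsub>A\<^esub> inv\<^bsub>A\<^esub> h"
        using hB Rc that by (simp add: c_def A.m_assoc cancel)
      then show ?thesis using R_perm_mult[OF that] by (simp add: c_def A_def)
    qed
    have "inj_on c (carrier G)"
    proof (rule inj_onI)
      fix g k assume gk: "g \<in> carrier G" "k \<in> carrier G" "c g = c k"
      have "(\<one>, 1) \<in> ?V" using m by (simp add: mem_vset_iff)
      then have v: "h (\<one>, 1) \<in> ?V" by (rule Bij_apply_mem[OF hV])
      have "c (k \<otimes> inv g) = c (inv g) \<otimes>\<^bsub>A\<^esub> c g" using gk by (simp add: c_mult)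
      also have "\<dots> = \<one>\<^bsub>A\<^esub>" using gk(1) c1 by (simp add: c_mult)
      finally have "k \<otimes> inv g = \<one>" using fixed[of "k \<otimes> inv g", OF _ v] gk v by (simp add: A_def)
      then show "g = k" using gk by (metis inv_equality inv_closed inv_inv)
    qed
    then have "bij_betw c (carrier G) X" by (simp add: bij_betw_def X)
    \<comment> \<open>As \<open>c\<close> reverses products, the isomorphism is its composition with inversion.\<close>
    then have "bij_betw (c \<circ> m_inv G) (carrier G) X"
      using bij_betw_trans bij_betw_byWitness[of "carrier G" "m_inv G" "m_inv G" "carrier G"]
      by fastforce
    moreover have "c \<circ> m_inv G \<in> hom G (A\<lparr>carrier := X\<rparr>)"
      by (rule homI) (auto simp: X c_mult inv_mult_group)
    ultimately show "G \<cong> A\<lparr>carrier := X\<rparr>"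
      by (auto simp: is_iso_def iso_def)
  qed
  have "orbit_set A X ?V = (\<lambda>u. (\<lambda>f. f (h u)) ` X) ` ?V"
  proof -
    have "h ` ?V = ?V" using hV by (simp add: Bij_def bij_betw_def)
    moreover have "(\<lambda>u. (\<lambda>f. f (h u)) ` X) ` ?V = (\<lambda>v. (\<lambda>f. f v) ` X) ` h ` ?V"
      by (simp only: image_image)
    ultimately show ?thesis by (simp only: orbit_set_eq)
  qed
  also have "\<dots> = (`) h ` (\<lambda>u. (\<lambda>f. f u) ` R_group G m) ` ?V"
    unfolding image_image
  proof (rule image_cong[OF refl])
    fix u assume u: "u \<in> ?V"
    have "(\<lambda>f. f (h u)) ` X = (\<lambda>g. h (R_perm G m g u)) ` carrier G"
      unfolding X image_image
      by (rule image_cong) (use u hV Bij_apply_mem[OF hV u] c_apply in \<open>auto simp: A_def\<close>)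
    then show "(\<lambda>f. f (h u)) ` X = (\<lambda>f. h (f u)) ` R_group G m"
      by (simp add: R_group_def image_image)
  qed
  also have "(\<lambda>u. (\<lambda>f. f u) ` R_group G m) ` ?V = layer G ` {1..m}"
    using orbit_set_R_group[OF group_axioms, of m] by (simp add: orbit_set_eq)
  also have "(`) h ` layer G ` {1..m} = layer G ` {1..m}"
    using h by (simp add: layer_perms_def)
  finally show "orbit_set A X ?V = layer G ` {1..m}" .
qed

text \<open>Conversely, let \<open>\<psi>\<close> be a bijection from \<open>G\<close> to \<open>X\<close> that reverses products. In each layer take
  the vertex of \<open>\<one>\<close> as base point, and let \<open>h\<close> send the vertex of \<open>x\<close> to the image of the base
  point under \<open>\<psi> x\<close>. Then \<open>\<psi> (x \<otimes> g) = \<psi> g \<circ> \<psi> x\<close> says that \<open>h\<close> intertwines right multiplication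
  by \<open>g\<close> with \<open>\<psi> g\<close>. It is surjective because \<open>X\<close> is transitive on each layer, and injective
  because \<open>X\<close> is semiregular.\<close>

lemma (in group) layer_regular_obtain_conjugator:
  fixes m :: nat
  defines "A \<equiv> BijGroup (vset G m)"
  assumes sub: "subgroup X A" and reg: "semiregular A X (vset G m)"
    and iso: "A\<lparr>carrier := X\<rparr> \<cong> G"
    and orb: "orbit_set A X (vset G m) = layer G ` {1..m}"
  obtains h where "h \<in> layer_perms G m" "X = h <#\<^bsub>A\<^esub> R_group G m #>\<^bsub>A\<^esub> inv\<^bsub>A\<^esub> h"
proof -
  let ?V = "vset G m"
  interpret A: group A unfolding A_def by (rule group_BijGroup)
  interpret X: group "A\<lparr>carrier := X\<rparr>" by (rule A.subgroup_imp_group[OF sub])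
  have XB: "X \<subseteq> Bij ?V" using subgroup.subset[OF sub] by (simp add: A_def)
  have "G \<cong> A\<lparr>carrier := X\<rparr>" by (rule X.iso_sym[OF iso])
  then obtain \<theta> where \<theta>: "\<theta> \<in> hom G (A\<lparr>carrier := X\<rparr>)" "bij_betw \<theta> (carrier G) X"
    by (auto simp: is_iso_def iso_def)
  define \<psi> where "\<psi> x = \<theta> (inv x)" for x
  have \<psi>_im: "\<psi> ` carrier G = X"
  proof -
    have "m_inv G ` carrier G = carrier G"
      by (auto simp: image_iff) (metis inv_closed inv_inv)
    then show ?thesis using \<theta>(2) unfolding \<psi>_def bij_betw_def by (metis image_image)
  qed
  have \<psi>_inj: "inj_on \<psi> (carrier G)"
    using \<theta>(2) unfolding \<psi>_def bij_betw_def inj_on_def by (metis inv_closed inv_inv)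
  have \<psi>_X: "\<psi> x \<in> X" "\<psi> x \<in> Bij ?V" if "x \<in> carrier G" for x
    using that \<psi>_im XB by auto
  have \<psi>_mult: "\<psi> (x \<otimes> g) = \<psi> g \<otimes>\<^bsub>A\<^esub> \<psi> x" if "x \<in> carrier G" "g \<in> carrier G" for x g
    using hom_mult[OF \<theta>(1), of "inv g" "inv x"] that by (simp add: \<psi>_def inv_mult_group)
  have orbit: "(\<lambda>f. f (\<one>, i)) ` X = layer G i" if i: "i \<in> {1..m}" for i
  proof -
    have b: "(\<one>, i) \<in> ?V" using i by (simp add: mem_vset_iff)
    then have "(\<lambda>f. f (\<one>, i)) ` X \<in> layer G ` {1..m}"
      using orb unfolding orbit_set_eq by blast
    moreover have "(\<one>, i) \<in> (\<lambda>f. f (\<one>, i)) ` X"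
      using subgroup.one_closed[OF sub] b
      by (intro image_eqI[of _ _ "\<one>\<^bsub>A\<^esub>"]) (auto simp: A_def)
    moreover have "L = layer G i" if "L \<in> layer G ` {1..m}" "(\<one>, i) \<in> L" for L
      using that by (auto simp: layer_def)
    ultimately show ?thesis by blast
  qed
  define h where "h = (\<lambda>(x, i) \<in> ?V. \<psi> x (\<one>, i))"
  have h_apply: "h (x, i) = \<psi> x (\<one>, i)" if "x \<in> carrier G" "i \<in> {1..m}" for x i
    using that by (simp add: h_def mem_vset_iff)
  have h_layer: "h ` layer G i = layer G i" if i: "i \<in> {1..m}" for i
  proof -
    have lay: "layer G i = (\<lambda>x. (x, i)) ` carrier G" by (auto simp: layer_def)
    have "h ` layer G i = (\<lambda>x. \<psi> x (\<one>, i)) ` carrier G"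
      unfolding lay image_image by (rule image_cong) (use i in \<open>simp_all add: h_apply\<close>)
    also have "\<dots> = (\<lambda>f. f (\<one>, i)) ` X" by (simp add: \<psi>_im[symmetric] image_image)
    finally show ?thesis using orbit[OF i] by simp
  qed
  have "inj_on h ?V"
  proof (rule inj_onI)
    fix u v assume uv: "u \<in> ?V" "v \<in> ?V" "h u = h v"
    obtain x i y j where [simp]: "u = (x, i)" "v = (y, j)" by (cases u; cases v)
    have xy: "x \<in> carrier G" "i \<in> {1..m}" "y \<in> carrier G" "j \<in> {1..m}"
      using uv by (simp_all add: mem_vset_iff)
    have "h u \<in> layer G i" "h v \<in> layer G j"
      using h_layer[of i] h_layer[of j] xy by (auto simp: layer_def)
    then have ij: "i = j" using uv(3) by (auto simp: layer_def)
    let ?f = "inv\<^bsub>A\<^esub> (\<psi> y) \<otimes>\<^bsub>A\<^esub> \<psi> x"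
    have b: "(\<one>, i) \<in> ?V" using xy by (simp add: mem_vset_iff)
    have "?f (\<one>, i) = (\<one>, i)"
      using uv(3) ij b \<psi>_X xy by (simp add: h_apply A_def Bij_inv_closed)
    moreover have "?f \<in> X"
      using \<psi>_X xy sub by (simp add: subgroup.m_closed subgroup.m_inv_closed)
    ultimately have "?f = \<one>\<^bsub>A\<^esub>"
      using reg b unfolding semiregular_iff by blast
    then have "\<psi> x = \<psi> y"
      using \<psi>_X xy A.inv_equality[of "inv\<^bsub>A\<^esub> (\<psi> y)" "\<psi> x"]
      by (metis A.inv_closed A.inv_comm A.inv_equality A.inv_inv A_def carrier_BijGroup)
    then show "u = v" using \<psi>_inj xy ij by (auto dest: inj_onD)
  qed
  moreover have "h ` ?V = ?V" unfolding vset_def image_UN using h_layer by auto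
  ultimately have hB: "h \<in> Bij ?V"
    by (simp add: Bij_def bij_betw_def h_def)
  have hL: "h \<in> layer_perms G m" by (rule layer_permsI[OF hB]) (use h_layer in blast)
  have conj: "h \<otimes>\<^bsub>A\<^esub> R_perm G m g \<otimes>\<^bsub>A\<^esub> inv\<^bsub>A\<^esub> h = \<psi> g" if g: "g \<in> carrier G" for g
  proof -
    note Rg = R_perm_Bij[OF g, of m]
    have "h \<otimes>\<^bsub>A\<^esub> R_perm G m g = \<psi> g \<otimes>\<^bsub>A\<^esub> h"
      unfolding A_def
    proof (rule Bij_eqI[where V = ?V])
      fix v assume v: "v \<in> ?V"
      obtain x i where [simp]: "v = (x, i)" by (cases v)
      have x: "x \<in> carrier G" "i \<in> {1..m}" using v by (simp_all add: mem_vset_iff)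
      have b: "(\<one>, i) \<in> ?V" using x by (simp add: mem_vset_iff)
      show "(h \<otimes>\<^bsub>BijGroup ?V\<^esub> R_perm G m g) v = (\<psi> g \<otimes>\<^bsub>BijGroup ?V\<^esub> h) v"
        using v b x g hB Rg \<psi>_X \<psi>_mult[OF x(1) g] by (simp add: h_apply A_def)
    qed (use hB Rg \<psi>_X g in \<open>auto simp: Bij_mult_closed\<close>)
    moreover have "h \<in> carrier A" "\<psi> g \<in> carrier A"
      using hB \<psi>_X[OF g] by (simp_all add: A_def)
    ultimately show ?thesis by (simp add: A.m_assoc)
  qed
  have "h <#\<^bsub>A\<^esub> R_group G m #>\<^bsub>A\<^esub> inv\<^bsub>A\<^esub> h = \<psi> ` carrier G"
    unfolding conjugate_eq_image R_group_def image_image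
    by (rule image_cong) (auto simp: conj)
  then show thesis using that[OF hL] \<psi>_im by simp
qed


section \<open>Partite Cayley digraphs and their isomorphic images\<close>

text \<open>Partite Cayley digraphs are characterized by their automorphisms, as in Sabidussi's theorem.
  The connection sets can be read off at the vertices of \<open>\<one>\<close>, since right multiplication by
  \<open>inv x\<close> moves an arc that starts at a vertex of \<open>x\<close> to one that starts there.\<close>

lemma (in group) m_PCayley_digraph_iff:
  "m_PCayley_digraph G m \<Sigma> \<longleftrightarrow> digraph_on (vset G m) \<Sigma> \<and>
    (\<forall>L\<in>layer G ` {1..m}. parcs \<Sigma> \<inter> L \<times> L = {}) \<and> R_group G m \<subseteq> carrier (Aut_digraph \<Sigma>)"
  (is "_ \<longleftrightarrow> digraph_on ?V \<Sigma> \<and> _ \<and> _")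
proof
  assume "m_PCayley_digraph G m \<Sigma>"
  then obtain S where S: "connection_sets G m S" and e: "\<And>i. i \<in> {1..m} \<Longrightarrow> S i i = {}"
    and \<Sigma>: "\<Sigma> = m_Cayley G m S" unfolding m_PCayley_digraph_def by blast
  note arc = in_parcs_m_Cayley_iff[OF group_axioms S, folded \<Sigma>]
  have V: "pverts \<Sigma> = ?V" by (simp add: \<Sigma> m_Cayley_def)
  have on: "digraph_on ?V \<Sigma>"
    using V arc by (auto simp: digraph_on_def mem_vset_iff)
  have "parcs \<Sigma> \<inter> layer G i \<times> layer G i = {}" if "i \<in> {1..m}" for i
    using e that by (auto simp: layer_def arc)
  moreover have "vertex_iso \<Sigma> \<Sigma> (R_perm G m g)" if g: "g \<in> carrier G" for g
  proof -
    have "g \<otimes> (inv g \<otimes> inv x) = inv x" if "x \<in> carrier G" for x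
      using that g by (simp add: m_assoc[symmetric])
    then have "(y \<otimes> g) \<otimes> inv (x \<otimes> g) = y \<otimes> inv x" if "x \<in> carrier G" "y \<in> carrier G" for x y
      using that g by (simp add: inv_mult_group m_assoc)
    then show ?thesis
      using R_perm_Bij[OF g, of m] g V
      by (auto simp: vertex_iso_def Bij_def mem_vset_iff arc)
  qed
  then have "R_group G m \<subseteq> carrier (Aut_digraph \<Sigma>)"
    by (auto simp: R_group_def Aut_digraph_def V R_perm_Bij)
  ultimately show "digraph_on ?V \<Sigma> \<and> (\<forall>L\<in>layer G ` {1..m}. parcs \<Sigma> \<inter> L \<times> L = {}) \<and>
      R_group G m \<subseteq> carrier (Aut_digraph \<Sigma>)" using on by blast
next
  assume r: "digraph_on ?V \<Sigma> \<and> (\<forall>L\<in>layer G ` {1..m}. parcs \<Sigma> \<inter> L \<times> L = {}) \<and>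
      R_group G m \<subseteq> carrier (Aut_digraph \<Sigma>)"
  then have V: "pverts \<Sigma> = ?V" "parcs \<Sigma> \<subseteq> ?V \<times> ?V" by (auto simp: digraph_on_def)
  define S where "S i j = {s. ((\<one>, i), (s, j)) \<in> parcs \<Sigma>}" for i j
  have e: "S i i = {}" if "i \<in> {1..m}" for i
    using r that V(2) by (fastforce simp: S_def layer_def mem_vset_iff)
  have S: "connection_sets G m S"
    using e V(2) unfolding connection_sets_def by (auto simp: S_def mem_vset_iff)
  note arc = in_parcs_m_Cayley_iff[OF group_axioms S]
  have shift: "((x, i), (y, j)) \<in> parcs \<Sigma> \<longleftrightarrow> ((\<one>, i), (y \<otimes> inv x, j)) \<in> parcs \<Sigma>"
    if "(x, i) \<in> ?V" "(y, j) \<in> ?V" for x y i j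
  proof -
    have x: "x \<in> carrier G" using that by (simp add: mem_vset_iff)
    then have "R_perm G m (inv x) \<in> R_group G m" by (simp add: R_group_def)
    then have "R_perm G m (inv x) \<in> carrier (Aut_digraph \<Sigma>)" using r by blast
    then have "vertex_iso \<Sigma> \<Sigma> (R_perm G m (inv x))" by (simp add: Aut_digraph_def)
    then show ?thesis using that x V(1) by (simp add: vertex_iso_def)
  qed
  have "((x, i), (y, j)) \<in> parcs \<Sigma> \<longleftrightarrow> ((x, i), (y, j)) \<in> parcs (m_Cayley G m S)" for x i y j
    using shift[of x i y j] V(2) unfolding arc by (auto simp: mem_vset_iff S_def)
  then have "parcs \<Sigma> = parcs (m_Cayley G m S)" by auto
  then have "\<Sigma> = m_Cayley G m S" using V(1) by (simp add: m_Cayley_def)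
  then show "m_PCayley_digraph G m \<Sigma>" using S e unfolding m_PCayley_digraph_def by blast
qed

lemma m_PCayley_digraph_on: "group G \<Longrightarrow> m_PCayley_digraph G m \<Gamma> \<Longrightarrow> digraph_on (vset G m) \<Gamma>"
  by (simp add: group.m_PCayley_digraph_iff)

text \<open>Layers without inner arcs are preserved by any permutation of the layers, so only the
  automorphism condition of \<open>m_PCayley_digraph_iff\<close> remains.\<close>

lemma (in group) m_PCayley_image_digraph_inv_iff:
  assumes \<Gamma>: "m_PCayley_digraph G m \<Gamma>" and h: "h \<in> layer_perms G m"
  defines "A \<equiv> BijGroup (vset G m)"
  shows "m_PCayley_digraph G m (image_digraph (inv\<^bsub>A\<^esub> h) \<Gamma>) \<longleftrightarrow>
    h <#\<^bsub>A\<^esub> R_group G m #>\<^bsub>A\<^esub> inv\<^bsub>A\<^esub> h \<subseteq> carrier (Aut_digraph \<Gamma>)"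
proof -
  let ?V = "vset G m"
  let ?\<Sigma> = "image_digraph (inv\<^bsub>A\<^esub> h) \<Gamma>"
  note on = m_PCayley_digraph_on[OF group_axioms \<Gamma>]
  note hB = layer_perms_Bij[OF h]
  have kB: "inv\<^bsub>A\<^esub> h \<in> Bij ?V" unfolding A_def by (rule Bij_inv_closed[OF hB])
  have on': "digraph_on ?V ?\<Sigma>" by (rule digraph_on_image_digraph[OF on kB])
  have "parcs ?\<Sigma> \<inter> L \<times> L = {}" if L: "L \<in> layer G ` {1..m}" for L
  proof -
    have hL: "h ` L \<in> layer G ` {1..m}" using h L unfolding layer_perms_def by blast
    have "(u, v) \<in> parcs \<Gamma> \<Longrightarrow> (inv\<^bsub>A\<^esub> h) u \<in> L \<Longrightarrow> (inv\<^bsub>A\<^esub> h) v \<in> L \<Longrightarrow> u \<in> h ` L \<and> v \<in> h ` L"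
      for u v
      using on BijGroup_inv_apply(1)[OF hB] unfolding digraph_on_def A_def
      by (metis imageI mem_Sigma_iff subsetD)
    then show ?thesis
      using \<Gamma> hL unfolding m_PCayley_digraph_iff parcs_image_digraph by fastforce
  qed
  moreover have "r \<in> carrier (Aut_digraph ?\<Sigma>) \<longleftrightarrow>
      h \<otimes>\<^bsub>A\<^esub> r \<otimes>\<^bsub>A\<^esub> inv\<^bsub>A\<^esub> h \<in> carrier (Aut_digraph \<Gamma>)" if "r \<in> R_group G m" for r
    using Aut_image_digraph_inv_iff[OF on hB, of r] R_group_subset[of m] that
    by (auto simp: A_def)
  then have "R_group G m \<subseteq> carrier (Aut_digraph ?\<Sigma>) \<longleftrightarrow>
      h <#\<^bsub>A\<^esub> R_group G m #>\<^bsub>A\<^esub> inv\<^bsub>A\<^esub> h \<subseteq> carrier (Aut_digraph \<Gamma>)"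
    unfolding conjugate_eq_image by blast
  ultimately show ?thesis using on' by (simp add: m_PCayley_digraph_iff)
qed

text \<open>The digraphs against which \<open>\<Gamma>\<close> is tested are the images \<open>h\<inverse> \<Gamma>\<close> with
  \<open>h R h\<inverse>\<close> in \<open>Aut \<Gamma>\<close> (fact \<open>competitors\<close>). For each of them a normalizing \<open>n\<close> and a
  conjugating automorphism \<open>a\<close> determine each other by \<open>a h n = 1\<close> (fact \<open>norm\<close>).\<close>

lemma (in group) mPCI_digraph_iff_conjugates:
  assumes \<Gamma>: "m_PCayley_digraph G m \<Gamma>"
  defines "A \<equiv> BijGroup (vset G m)"
  shows "mPCI_digraph G m \<Gamma> \<longleftrightarrow>
    (\<forall>h\<in>layer_perms G m.
      h <#\<^bsub>A\<^esub> R_group G m #>\<^bsub>A\<^esub> inv\<^bsub>A\<^esub> h \<subseteq> carrier (Aut_digraph \<Gamma>) \<longrightarrow>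
      conjugate_in (Aut_digraph \<Gamma>) (h <#\<^bsub>A\<^esub> R_group G m #>\<^bsub>A\<^esub> inv\<^bsub>A\<^esub> h) (R_group G m))"
proof -
  let ?V = "vset G m" and ?R = "R_group G m"
  interpret A: group A unfolding A_def by (rule group_BijGroup)
  have cA: "carrier A = Bij ?V" by (simp add: A_def)
  note on = m_PCayley_digraph_on[OF group_axioms \<Gamma>]
  have RA: "?R \<subseteq> carrier A" using R_group_subset cA by simp
  have Aut: "carrier (Aut_digraph \<Gamma>) = {a \<in> carrier A. image_digraph a \<Gamma> = \<Gamma>}"
    using carrier_Aut_digraph[OF on] cA by simp
  have N: "N_group G m = {n \<in> carrier A. n <#\<^bsub>A\<^esub> ?R #>\<^bsub>A\<^esub> inv\<^bsub>A\<^esub> n = ?R}"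
    using N_group_eq cA by (simp add: A_def)
  have norm: "(\<exists>n\<in>N_group G m. image_digraph n \<Gamma> = image_digraph (inv\<^bsub>A\<^esub> h) \<Gamma>) \<longleftrightarrow>
      (\<exists>a\<in>carrier (Aut_digraph \<Gamma>).
        a <#\<^bsub>A\<^esub> (h <#\<^bsub>A\<^esub> ?R #>\<^bsub>A\<^esub> inv\<^bsub>A\<^esub> h) #>\<^bsub>A\<^esub> inv\<^bsub>A\<^esub> a = ?R)"
    if h: "h \<in> carrier A" for h
  proof
    assume "\<exists>n\<in>N_group G m. image_digraph n \<Gamma> = image_digraph (inv\<^bsub>A\<^esub> h) \<Gamma>"
    then obtain n where n: "n \<in> carrier A" "n <#\<^bsub>A\<^esub> ?R #>\<^bsub>A\<^esub> inv\<^bsub>A\<^esub> n = ?R"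
      "image_digraph n \<Gamma> = image_digraph (inv\<^bsub>A\<^esub> h) \<Gamma>" by (auto simp: N)
    let ?a = "inv\<^bsub>A\<^esub> (h \<otimes>\<^bsub>A\<^esub> n)"
    have "image_digraph (h \<otimes>\<^bsub>A\<^esub> n) \<Gamma> = image_digraph (h \<otimes>\<^bsub>A\<^esub> inv\<^bsub>A\<^esub> h) \<Gamma>"
      using image_digraph_mult[OF on] h n(1,3) A.inv_closed[OF h] by (simp add: A_def)
    then have "image_digraph (h \<otimes>\<^bsub>A\<^esub> n) \<Gamma> = \<Gamma>"
      using h image_digraph_one[OF on] by (simp add: A_def A.r_inv[unfolded A_def])
    then have "?a \<in> carrier (Aut_digraph \<Gamma>)"
      using image_digraph_inv_eq_iff[OF on on] h n(1) A.m_closed[OF h n(1)] A.inv_closed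
      unfolding Aut by (simp add: A_def)
    moreover have "?a \<otimes>\<^bsub>A\<^esub> h = inv\<^bsub>A\<^esub> n"
      using h n(1) by (simp add: A.inv_mult_group A.m_assoc)
    then have "?a <#\<^bsub>A\<^esub> (h <#\<^bsub>A\<^esub> ?R #>\<^bsub>A\<^esub> inv\<^bsub>A\<^esub> h) #>\<^bsub>A\<^esub> inv\<^bsub>A\<^esub> ?a = ?R"
      using A.conjugate_mult[of ?a h ?R] A.conjugate_inv_eq_iff[OF n(1) RA RA] n(1,2) h RA
      by simp
    ultimately show "\<exists>a\<in>carrier (Aut_digraph \<Gamma>).
        a <#\<^bsub>A\<^esub> (h <#\<^bsub>A\<^esub> ?R #>\<^bsub>A\<^esub> inv\<^bsub>A\<^esub> h) #>\<^bsub>A\<^esub> inv\<^bsub>A\<^esub> a = ?R" by blast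
  next
    assume "\<exists>a\<in>carrier (Aut_digraph \<Gamma>).
        a <#\<^bsub>A\<^esub> (h <#\<^bsub>A\<^esub> ?R #>\<^bsub>A\<^esub> inv\<^bsub>A\<^esub> h) #>\<^bsub>A\<^esub> inv\<^bsub>A\<^esub> a = ?R"
    then obtain a where a: "a \<in> carrier A" "image_digraph a \<Gamma> = \<Gamma>"
      "(a \<otimes>\<^bsub>A\<^esub> h) <#\<^bsub>A\<^esub> ?R #>\<^bsub>A\<^esub> inv\<^bsub>A\<^esub> (a \<otimes>\<^bsub>A\<^esub> h) = ?R"
      using A.conjugate_mult[OF _ h RA] by (auto simp: Aut)
    let ?n = "inv\<^bsub>A\<^esub> (a \<otimes>\<^bsub>A\<^esub> h)"
    have "?n \<in> N_group G m"
      using A.conjugate_inv_eq_iff[OF A.m_closed[OF a(1) h] RA RA] a h by (simp add: N)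
    moreover have "image_digraph (inv\<^bsub>A\<^esub> a) \<Gamma> = \<Gamma>"
      using image_digraph_inv_eq_iff[OF on on] a by (simp add: A_def)
    then have "image_digraph ?n \<Gamma> = image_digraph (inv\<^bsub>A\<^esub> h) \<Gamma>"
      using image_digraph_mult[OF on, of "inv\<^bsub>A\<^esub> h" "inv\<^bsub>A\<^esub> a"] A.inv_mult_group[OF a(1) h]
        A.inv_closed[OF h] A.inv_closed[OF a(1)] by (simp add: A_def)
    ultimately show "\<exists>n\<in>N_group G m. image_digraph n \<Gamma> = image_digraph (inv\<^bsub>A\<^esub> h) \<Gamma>" by blast
  qed
  have competitors: "m_PCayley_digraph G m \<Sigma> \<and> p_isomorphic G m \<Gamma> \<Sigma> \<longleftrightarrow>
      (\<exists>h\<in>layer_perms G m. \<Sigma> = image_digraph (inv\<^bsub>A\<^esub> h) \<Gamma> \<and>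
        h <#\<^bsub>A\<^esub> ?R #>\<^bsub>A\<^esub> inv\<^bsub>A\<^esub> h \<subseteq> carrier (Aut_digraph \<Gamma>))" (is "?l \<longleftrightarrow> ?r") for \<Sigma>
  proof
    assume l: ?l
    then obtain f where f: "f \<in> layer_perms G m" "image_digraph f \<Gamma> = \<Sigma>"
      using p_isomorphic_iff_layer_perms[OF on m_PCayley_digraph_on[OF group_axioms]] by blast
    have "inv\<^bsub>A\<^esub> f \<in> layer_perms G m" "inv\<^bsub>A\<^esub> (inv\<^bsub>A\<^esub> f) = f"
      using layer_perms_inv[OF f(1)] layer_perms_Bij[OF f(1)] A.inv_inv[of f]
      by (simp_all add: A_def)
    then show ?r
      using m_PCayley_image_digraph_inv_iff[OF \<Gamma>, of "inv\<^bsub>A\<^esub> f"] f l unfolding A_def by metis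
  next
    assume ?r
    then obtain h where h: "h \<in> layer_perms G m" "\<Sigma> = image_digraph (inv\<^bsub>A\<^esub> h) \<Gamma>"
      "h <#\<^bsub>A\<^esub> ?R #>\<^bsub>A\<^esub> inv\<^bsub>A\<^esub> h \<subseteq> carrier (Aut_digraph \<Gamma>)" by blast
    have \<Sigma>: "m_PCayley_digraph G m \<Sigma>"
      using m_PCayley_image_digraph_inv_iff[OF \<Gamma> h(1)] h(2,3) by (simp add: A_def)
    then show ?l
      using p_isomorphic_iff_layer_perms[OF on m_PCayley_digraph_on[OF group_axioms \<Sigma>]]
        layer_perms_inv[OF h(1)] h(2) by (auto simp: A_def)
  qed
  have "mPCI_digraph G m \<Gamma> \<longleftrightarrow> (\<forall>h\<in>layer_perms G m.
      h <#\<^bsub>A\<^esub> ?R #>\<^bsub>A\<^esub> inv\<^bsub>A\<^esub> h \<subseteq> carrier (Aut_digraph \<Gamma>) \<longrightarrow>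
      (\<exists>n\<in>N_group G m. image_digraph n \<Gamma> = image_digraph (inv\<^bsub>A\<^esub> h) \<Gamma>))"
    unfolding mPCI_digraph_def competitors by blast
  moreover have "(\<exists>n\<in>N_group G m. image_digraph n \<Gamma> = image_digraph (inv\<^bsub>A\<^esub> h) \<Gamma>) \<longleftrightarrow>
      conjugate_in (Aut_digraph \<Gamma>) (h <#\<^bsub>A\<^esub> ?R #>\<^bsub>A\<^esub> inv\<^bsub>A\<^esub> h) ?R"
    if "h \<in> layer_perms G m" "h <#\<^bsub>A\<^esub> ?R #>\<^bsub>A\<^esub> inv\<^bsub>A\<^esub> h \<subseteq> carrier (Aut_digraph \<Gamma>)" for h
    using norm[of h] layer_perms_Bij[OF that(1)] cA
      conjugate_in_Aut_digraph_iff[OF on that(2), folded A_def] by simp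
  ultimately show ?thesis by blast
qed

lemma pair_graph_vertex_iso:
  assumes \<Gamma>: "pair_graph \<Gamma>" and \<Sigma>: "pair_wf_digraph \<Sigma>" and iso: "vertex_iso \<Gamma> \<Sigma> f"
  shows "pair_graph \<Sigma>"
proof -
  interpret \<Gamma>: pair_graph \<Gamma> by fact
  interpret \<Sigma>: pair_wf_digraph \<Sigma> by fact
  have im: "pverts \<Sigma> = f ` pverts \<Gamma>"
    using iso by (auto simp: vertex_iso_def bij_betw_def)
  have fin: "finite (pverts \<Sigma>)" using im \<Gamma>.pair_finite_verts by simp
  have sub: "parcs \<Sigma> \<subseteq> pverts \<Sigma> \<times> pverts \<Sigma>"
    using \<Sigma>.arc_fst_in_verts \<Sigma>.arc_snd_in_verts by fastforce
  have pull: "\<exists>u\<in>pverts \<Gamma>. \<exists>v\<in>pverts \<Gamma>. a = f u \<and> b = f v \<and> (u, v) \<in> parcs \<Gamma>"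
    if "(a, b) \<in> parcs \<Sigma>" for a b
    using that sub im iso unfolding vertex_iso_def by (smt (verit) SigmaD1 SigmaD2 imageE subsetD)
  have "sym (parcs \<Sigma>)"
  proof (rule symI)
    fix a b assume "(a, b) \<in> parcs \<Sigma>"
    then obtain u v where "u \<in> pverts \<Gamma>" "v \<in> pverts \<Gamma>" "a = f u" "b = f v" "(u, v) \<in> parcs \<Gamma>"
      using pull by blast
    moreover from this have "(v, u) \<in> parcs \<Gamma>"
      using \<Gamma>.pair_sym_arcs unfolding symmetric_def by (auto dest: symD)
    ultimately show "(b, a) \<in> parcs \<Sigma>" using iso by (auto simp: vertex_iso_def)
  qed
  moreover have "fst e \<noteq> snd e" if "e \<in> parcs \<Sigma>" for e
  proof
    assume loop: "fst e = snd e"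
    have "(fst e, snd e) \<in> parcs \<Sigma>" using that by simp
    from pull[OF this] loop obtain u v
      where "u \<in> pverts \<Gamma>" "v \<in> pverts \<Gamma>" "f u = f v" "(u, v) \<in> parcs \<Gamma>" by metis
    moreover from this have "u = v" using iso by (auto simp: vertex_iso_def bij_betw_def inj_on_def)
    ultimately show False using \<Gamma>.pair_no_loops by fastforce
  qed
  moreover have "finite (parcs \<Sigma>)" by (rule finite_subset[OF sub]) (use fin in simp)
  ultimately show ?thesis
    using fin by unfold_locales (auto simp: symmetric_def)
qed

text \<open>Every digraph against which a graph is tested is isomorphic to it, hence is itself a graph.\<close>

lemma (in group) mPCI_graph_iff_mPCI_digraph:
  assumes "m_PCayley_graph G m \<Gamma>"
  shows "mPCI_graph G m \<Gamma> \<longleftrightarrow> mPCI_digraph G m \<Gamma>"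
proof -
  have "m_PCayley_graph G m \<Sigma> \<longleftrightarrow> m_PCayley_digraph G m \<Sigma>" if "p_isomorphic G m \<Gamma> \<Sigma>" for \<Sigma>
  proof
    assume \<Sigma>: "m_PCayley_digraph G m \<Sigma>"
    then have "pair_wf_digraph \<Sigma>"
      using m_PCayley_digraph_on[OF group_axioms \<Sigma>]
      by unfold_locales (auto simp: digraph_on_def)
    then show "m_PCayley_graph G m \<Sigma>"
      using pair_graph_vertex_iso assms that \<Sigma>
      unfolding m_PCayley_graph_def p_isomorphic_def by blast
  qed (simp add: m_PCayley_graph_def)
  then show ?thesis unfolding mPCI_graph_def mPCI_digraph_def by blast
qed

lemma (in group) mPCI_digraph_iff_semiregular_conjugate:
  assumes m: "0 < m" and \<Gamma>: "m_PCayley_digraph G m \<Gamma>"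
  shows "mPCI_digraph G m \<Gamma> \<longleftrightarrow>
    (\<forall>X. subgroup X (Aut_digraph \<Gamma>) \<and>
         semiregular (Aut_digraph \<Gamma>) X (vset G m) \<and>
         (Aut_digraph \<Gamma>)\<lparr>carrier := X\<rparr> \<cong> G \<and>
         orbit_set (Aut_digraph \<Gamma>) X (vset G m) = layer G ` {1..m} \<longrightarrow>
         conjugate_in (Aut_digraph \<Gamma>) X (R_group G m))"
proof -
  let ?V = "vset G m" and ?C = "carrier (Aut_digraph \<Gamma>)" and ?Aut = "Aut_digraph \<Gamma>"
  define A where "A = BijGroup ?V"
  interpret A: group A unfolding A_def by (rule group_BijGroup)
  note on = m_PCayley_digraph_on[OF group_axioms \<Gamma>]
  have eq: "?Aut = A\<lparr>carrier := ?C\<rparr>" unfolding A_def by (rule Aut_digraph_eq[OF on])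
  have C: "subgroup ?C A" unfolding A_def by (rule subgroup_Aut_digraph[OF on])
  have sub: "subgroup X ?Aut \<longleftrightarrow> subgroup X A \<and> X \<subseteq> ?C" for X
    using A.subgroup_incl[OF _ C] A.incl_subgroup[OF C] subgroup.subset[of X ?Aut] eq by metis
  have "\<one>\<^bsub>?Aut\<^esub> = \<one>\<^bsub>A\<^esub>" by (subst eq) simp
  then have semi: "semiregular ?Aut X ?V \<longleftrightarrow> semiregular A X ?V" for X
    by (simp only: semiregular_iff)
  have orb: "orbit_set ?Aut X ?V = orbit_set A X ?V" for X
    by (simp only: orbit_set_eq)
  have car: "?Aut\<lparr>carrier := X\<rparr> = A\<lparr>carrier := X\<rparr>" for X by (subst eq) simp
  have good_iff: "subgroup X ?Aut \<and> semiregular ?Aut X ?V \<and> ?Aut\<lparr>carrier := X\<rparr> \<cong> G \<and>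
      orbit_set ?Aut X ?V = layer G ` {1..m} \<longleftrightarrow>
      X \<subseteq> ?C \<and> (\<exists>h\<in>layer_perms G m. X = h <#\<^bsub>A\<^esub> R_group G m #>\<^bsub>A\<^esub> inv\<^bsub>A\<^esub> h)"
    (is "?good \<longleftrightarrow> ?conj") for X
  proof
    assume ?good
    then have g: "X \<subseteq> ?C" "subgroup X A" "semiregular A X ?V" "A\<lparr>carrier := X\<rparr> \<cong> G"
      "orbit_set A X ?V = layer G ` {1..m}"
      unfolding sub car semi orb by auto
    then obtain h where "h \<in> layer_perms G m" "X = h <#\<^bsub>A\<^esub> R_group G m #>\<^bsub>A\<^esub> inv\<^bsub>A\<^esub> h"
      using layer_regular_obtain_conjugator[of X m, folded A_def] by blast
    then show ?conj using g(1) by blast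
  next
    assume ?conj
    then obtain h where h: "X \<subseteq> ?C" "h \<in> layer_perms G m"
      "X = h <#\<^bsub>A\<^esub> R_group G m #>\<^bsub>A\<^esub> inv\<^bsub>A\<^esub> h" by blast
    then show ?good
      using conjugate_R_group_layer_regular[OF m h(2), folded A_def, folded h(3)]
      unfolding sub car semi orb by blast
  qed
  show ?thesis
    unfolding mPCI_digraph_iff_conjugates[OF \<Gamma>, folded A_def] good_iff by auto
qed

theorem theorem4p5:
  fixes G :: "('a, 'b) monoid_scheme"
    and m :: nat
    and S :: "nat \<Rightarrow> nat \<Rightarrow> 'a set"
    and \<Gamma> :: "('a \<times> nat) pair_pre_digraph"
  assumes "group G" and "finite (carrier G)" and "0 < m"
    and "connection_sets G m S" and "\<Gamma> = m_Cayley G m S"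
  shows "(m_PCayley_digraph G m \<Gamma> \<longrightarrow>
      (mPCI_digraph G m \<Gamma> \<longleftrightarrow>
        (\<forall>X. subgroup X (Aut_digraph \<Gamma>) \<and>
             semiregular (Aut_digraph \<Gamma>) X (vset G m) \<and>
             (Aut_digraph \<Gamma>)\<lparr>carrier := X\<rparr> \<cong> G \<and>
             orbit_set (Aut_digraph \<Gamma>) X (vset G m) = layer G ` {1..m} \<longrightarrow>
             conjugate_in (Aut_digraph \<Gamma>) X (R_group G m))))
    \<and> (m_PCayley_graph G m \<Gamma> \<longrightarrow>
      (mPCI_graph G m \<Gamma> \<longleftrightarrow>
        (\<forall>X. subgroup X (Aut_digraph \<Gamma>) \<and>
             semiregular (Aut_digraph \<Gamma>) X (vset G m) \<and>
             (Aut_digraph \<Gamma>)\<lparr>carrier := X\<rparr> \<cong> G \<and>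
             orbit_set (Aut_digraph \<Gamma>) X (vset G m) = layer G ` {1..m} \<longrightarrow>
             conjugate_in (Aut_digraph \<Gamma>) X (R_group G m))))"
proof -
  interpret group G by fact
  show ?thesis
    using mPCI_digraph_iff_semiregular_conjugate[OF \<open>0 < m\<close>, of \<Gamma>]
      mPCI_graph_iff_mPCI_digraph[of m \<Gamma>]
    unfolding m_PCayley_graph_def by blast
qed

end
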